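(* For every integer $n \geq 2$, the smallest positive integer $k$ for which there exists a map $f: E(H_n) \to \{1,2,\dots,k\}$ (not necessarily a proper edge coloring) such that all vertices of $H_n$ are distinguished by $f$ is $k = 2$.
   Context: The $n$-dimensional hypercube $H_n$ is the graph whose vertices are the binary sequences of length $n$, two vertices being adjacent if the sequences differ in exactly one position; if they differ in position $i$, the edge is said to be of dimension $i$. For a vertex $x$ of $H_n$, let $e_i(x)$ denote the unique edge of dimension $i$ incident to $x$. For an edge coloring $f: E(H_n) \to \{1,\dots,k\}$, the palette at $x$ is the sequence $F(x) = (f(e_1(x)), f(e_2(x)), \dots, f(e_n(x)))$. Two vertices are distinguished by $f$ if their palettes are different sequences; all vertices are distinguished by $f$ if the palettes of any two distinct vertices differ. *)

theory Defs
  imports Main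
begin

(* The hypercube H_n. Positions, hence dimensions, are 0, ..., n - 1 (list indices). *)

definition cube_verts :: "nat \<Rightarrow> bool list set" where
  "cube_verts n = {x. length x = n}"

definition diff_positions :: "nat \<Rightarrow> bool list \<Rightarrow> bool list \<Rightarrow> nat set" where
  "diff_positions n x y = {i. i < n \<and> x ! i \<noteq> y ! i}"

definition cube_edges :: "nat \<Rightarrow> bool list set set" where
  "cube_edges n = {{x, y} | x y. x \<in> cube_verts n \<and> y \<in> cube_verts n \<and>
                                 card (diff_positions n x y) = 1}"

definition cube_edges_dim :: "nat \<Rightarrow> nat \<Rightarrow> bool list set set" where
  "cube_edges_dim n i = {{x, y} | x y. x \<in> cube_verts n \<and> y \<in> cube_verts n \<and>
                                       diff_positions n x y = {i}}"

definition edge_at :: "nat \<Rightarrow> nat \<Rightarrow> bool list \<Rightarrow> bool list set" where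
  "edge_at n i x = (THE e. e \<in> cube_edges_dim n i \<and> x \<in> e)"

definition palette :: "nat \<Rightarrow> (bool list set \<Rightarrow> nat) \<Rightarrow> bool list \<Rightarrow> nat list" where
  "palette n f x = map (\<lambda>i. f (edge_at n i x)) [0..<n]"

definition all_distinguished :: "nat \<Rightarrow> (bool list set \<Rightarrow> nat) \<Rightarrow> bool" where
  "all_distinguished n f \<longleftrightarrow>
     (\<forall>x\<in>cube_verts n. \<forall>y\<in>cube_verts n. x \<noteq> y \<longrightarrow> palette n f x \<noteq> palette n f y)"

(* Only the values of f on the edges of H_n matter. *)
definition distinguishable_with :: "nat \<Rightarrow> nat \<Rightarrow> bool" where
  "distinguishable_with n k \<longleftrightarrow>
     (\<exists>f. (\<forall>e\<in>cube_edges n. f e \<in> {1..k}) \<and> all_distinguished n f)"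

(* The description in edge_at is proper: the edge exists and is unique. *)

lemma cube_edges_dim_iff:
  assumes "x \<in> cube_verts n" "i < n"
  shows "e \<in> cube_edges_dim n i \<and> x \<in> e \<longleftrightarrow> e = {x, x[i := \<not> x ! i]}"
proof
  have flip: "b = a[i := \<not> a ! i]"
    if "length a = n" "length b = n" "diff_positions n a b = {i}" for a b
  proof (rule nth_equalityI)
    fix j assume "j < length b"
    have "j \<in> diff_positions n a b \<longleftrightarrow> j = i" using that(3) by simp
    then show "b ! j = a[i := \<not> a ! i] ! j"
      using that(1,2) \<open>j < length b\<close> by (auto simp: diff_positions_def nth_list_update)
  qed (use that in simp)
  have sym: "diff_positions n a b = diff_positions n b a" for a b
    by (auto simp: diff_positions_def)
  assume "e \<in> cube_edges_dim n i \<and> x \<in> e"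
  then obtain a b where ab: "e = {a, b}" "length a = n" "length b = n"
      "diff_positions n a b = {i}" "x = a \<or> x = b"
    by (auto simp: cube_edges_dim_def cube_verts_def)
  show "e = {x, x[i := \<not> x ! i]}"
    using ab flip[of a b] flip[of b a] sym[of a b] by (metis insert_commute)
next
  assume e: "e = {x, x[i := \<not> x ! i]}"
  have "diff_positions n x (x[i := \<not> x ! i]) = {i}"
    using assms by (auto simp: diff_positions_def cube_verts_def nth_list_update)
  moreover have "x[i := \<not> x ! i] \<in> cube_verts n"
    using assms by (simp add: cube_verts_def)
  ultimately show "e \<in> cube_edges_dim n i \<and> x \<in> e"
    unfolding e cube_edges_dim_def using assms(1) by blast
qed

lemma edge_at_eq:
  assumes "x \<in> cube_verts n" "i < n"
  shows "edge_at n i x = {x, x[i := \<not> x ! i]}"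
  unfolding edge_at_def cube_edges_dim_iff[OF assms] by simp

end

(* Colour an edge of dimension i by the common (i + 1)-st coordinate, taken cyclically, of its
   two ends: for n >= 2 this is not the coordinate in which they differ. The palette at x is then
   the cyclic rotation of x, so it determines x. *)

theory Submission
  imports Defs
begin

lemma edge_at_in_cube_edges:
  assumes "x \<in> cube_verts n" "i < n"
  shows "edge_at n i x \<in> cube_edges n"
proof -
  have "edge_at n i x \<in> cube_edges_dim n i"
    using cube_edges_dim_iff[OF assms] edge_at_eq[OF assms] by blast
  then obtain u v where "edge_at n i x = {u, v}" "u \<in> cube_verts n" "v \<in> cube_verts n"
      "diff_positions n u v = {i}"
    unfolding cube_edges_dim_def by blast
  moreover from this have "card (diff_positions n u v) = 1"
    by simp
  ultimately show ?thesis
    unfolding cube_edges_def by blast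
qed

text \<open>The two ends of an edge differ only in its dimension, so whichever end is used to write
  the edge, the dimension and all other coordinates come out the same. This makes it possible to
  colour an edge by a coordinate of either end.\<close>

lemma flip_pair_eqD:
  assumes "{x, x[i := \<not> x ! i]} = {y, y[j := \<not> y ! j]}" "i < length x" "j < length y"
  shows "i = j" and "k \<noteq> i \<Longrightarrow> x ! k = y ! k"
proof -
  consider "y = x" "x[i := \<not> x ! i] = y[j := \<not> y ! j]"
    | "x = y[j := \<not> y ! j]" "y = x[i := \<not> x ! i]"
    using assms(1) unfolding doubleton_eq_iff by metis
  then have "i = j \<and> (k \<noteq> i \<longrightarrow> x ! k = y ! k)"
  proof cases
    \<comment> \<open>Both sides flip the same vertex. If \<open>i\<close> and \<open>j\<close>
      differed, flipping at \<open>j\<close> would leave entry \<open>i\<close> unchanged.\<close>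
    case 1
    then have "x[j := \<not> x ! j] ! i = (\<not> x ! i)"
      using assms(2) by (metis nth_list_update_eq)
    then have "i = j"
      by (metis nth_list_update_neq)
    with 1(1) show ?thesis by simp
  next
    \<comment> \<open>The base vertices are opposite ends: they differ at \<open>i\<close>, yet
      flipping \<open>y\<close> at \<open>j\<close> gives \<open>x\<close>, which forces
      \<open>i = j\<close>.\<close>
    case 2
    have "x ! i = y[j := \<not> y ! j] ! i" "y ! i = (\<not> x ! i)"
      using 2 assms(2) by (metis, simp)
    then have "i = j"
      by (metis nth_list_update_neq)
    moreover have "y ! k = x ! k" if "k \<noteq> i"
      using that by (subst 2(2)) simp
    ultimately show ?thesis by auto
  qed
  then show "i = j" and "k \<noteq> i \<Longrightarrow> x ! k = y ! k" by auto
qed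

text \<open>An edge is an unordered pair with no preferred end, hence the existential over its
  representations. Sets that are not edges get the default 1.\<close>

definition next_coordinate_colouring :: "nat \<Rightarrow> bool list set \<Rightarrow> nat" where
  "next_coordinate_colouring n e =
     (if \<exists>x\<in>cube_verts n. \<exists>i<n. e = {x, x[i := \<not> x ! i]} \<and> x ! (Suc i mod n) then 2 else 1)"

lemma next_coordinate_colouring_edge_at:
  assumes "n \<ge> 2" "x \<in> cube_verts n" "i < n"
  shows "next_coordinate_colouring n (edge_at n i x) = (if x ! (Suc i mod n) then 2 else 1)"
proof -
  \<comment> \<open>For \<open>i = n - 1\<close> the successor wraps to 0, which differs from
    \<open>i\<close> because \<open>n \<ge> 2\<close>.\<close>
  have ne: "Suc i mod n \<noteq> i"
    using assms(1,3) by (cases "Suc i = n") auto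
  \<comment> \<open>No other representation of the edge can force colour 2 when the one based at
    \<open>x\<close> does not.\<close>
  have "x ! (Suc i mod n)"
    if "y \<in> cube_verts n" "j < n" "{x, x[i := \<not> x ! i]} = {y, y[j := \<not> y ! j]}"
      "y ! (Suc j mod n)" for y j
  proof -
    have len: "i < length x" "j < length y"
      using that(1,2) assms(2,3) by (simp_all add: cube_verts_def)
    show ?thesis
      using flip_pair_eqD(1)[OF that(3) len] flip_pair_eqD(2)[OF that(3) len ne] that(4) by argo
  qed
  then show ?thesis
    unfolding next_coordinate_colouring_def edge_at_eq[OF assms(2,3)]
    using assms(2,3) by (smt (verit, best))
qed

lemma all_distinguished_next_coordinate_colouring:
  assumes "n \<ge> 2"
  shows "all_distinguished n (next_coordinate_colouring n)"
  unfolding all_distinguished_def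
proof (intro ballI impI notI)
  fix x y
  assume xy: "x \<in> cube_verts n" "y \<in> cube_verts n" "x \<noteq> y"
    and eq: "palette n (next_coordinate_colouring n) x = palette n (next_coordinate_colouring n) y"
  have rot: "x ! (Suc i mod n) = y ! (Suc i mod n)" if "i < n" for i
  proof -
    have "next_coordinate_colouring n (edge_at n i x) = next_coordinate_colouring n (edge_at n i y)"
      using eq that by (simp add: palette_def)
    then show ?thesis
      using assms xy that by (simp add: next_coordinate_colouring_edge_at split: if_splits)
  qed
  have "x ! k = y ! k" if "k < n" for k
  \<comment> \<open>Coordinate 0 is recorded by the last palette entry, coordinate
    \<open>Suc m\<close> by entry \<open>m\<close>.\<close>
  proof (cases k)
    case 0
    then show ?thesis
      using rot[of "n - 1"] assms by simp
  next
    case (Suc m)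
    then show ?thesis
      using rot[of m] that by simp
  qed
  then show False
    using xy by (simp add: cube_verts_def list_eq_iff_nth_eq)
qed

lemma distinguishable_with_2:
  assumes "n \<ge> 2"
  shows "distinguishable_with n 2"
proof -
  have "next_coordinate_colouring n e \<in> {1..2}" for e
    by (simp add: next_coordinate_colouring_def)
  then show ?thesis
    using all_distinguished_next_coordinate_colouring[OF assms]
    unfolding distinguishable_with_def by blast
qed

text \<open>A single colour makes all palettes equal, while for \<open>n > 0\<close> the two
  constant sequences are distinct vertices.\<close>

lemma not_distinguishable_with_1:
  assumes "n > 0"
  shows "\<not> distinguishable_with n 1"
proof
  assume "distinguishable_with n 1"
  then obtain f where f: "\<And>e. e \<in> cube_edges n \<Longrightarrow> f e = 1" and dist: "all_distinguished n f"
    by (auto simp: distinguishable_with_def)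
  have "palette n f x = replicate n 1" if "x \<in> cube_verts n" for x
    using that by (auto simp: palette_def list_eq_iff_nth_eq f edge_at_in_cube_edges)
  moreover have "replicate n b \<in> cube_verts n" for b
    by (simp add: cube_verts_def)
  moreover have "replicate n True \<noteq> replicate n False"
    using assms by simp
  ultimately show False
    using dist unfolding all_distinguished_def by metis
qed

theorem theorem1:
  fixes n :: nat
  assumes "n \<ge> 2"
  shows "distinguishable_with n 2 \<and> (\<forall>k\<ge>1. distinguishable_with n k \<longrightarrow> 2 \<le> k)"
proof (intro conjI allI impI)
  show "distinguishable_with n 2"
    using assms by (rule distinguishable_with_2)
  fix k :: nat
  assume "k \<ge> 1" "distinguishable_with n k"
  moreover have "k \<noteq> 1"
    using not_distinguishable_with_1[of n] assms \<open>distinguishable_with n k\<close> by auto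
  ultimately show "2 \<le> k" by simp
qed

end
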